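(* Let $k,d,n$ be nonnegative integers. If there is a $[k,d,n]$ PSF family in which the size of every set is at most $k+d$, then for every positive integer $r$, $\mathrm{CF}(B_{d(r+1)+kr})\le nr+d$.
   Context: An ordered set is a finite sequence of distinct elements of a ground set. A family $\mathcal F$ of ordered sets is prefix set-free (PSF) if for any two distinct members $A,B\in\mathcal F$, no prefix of $A$ equals $B$ as an (unordered) set. If the ground set has $n$ elements, every member of $\mathcal F$ has length at least $k$, and $|\mathcal F|\ge 2^d$, then $\mathcal F$ is called a $[k,d,n]$ PSF family. $B_m$ is the rooted complete binary tree with $m$ levels. For a graph $G$, a conflict-free coloring w.r.t. paths is a function $C\colon V(G)\to\{1,\dots,c\}$ such that for the vertex set of every path of $G$ (including single vertices) some color occurs exactly once on it; $\mathrm{CF}(G)$ is the minimum such $c$. *)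

theory Defs
  imports "Graph_Theory.Graph_Theory" "HOL-Library.Sublist"
begin

definition ordered_set :: "'a set \<Rightarrow> 'a list \<Rightarrow> bool" where
  "ordered_set X A \<longleftrightarrow> distinct A \<and> set A \<subseteq> X"

text \<open>
  Prefixes may be empty or improper; in particular, two distinct members never have the same
  underlying set.
\<close>

definition prefix_set_free :: "'a list set \<Rightarrow> bool" where
  "prefix_set_free F \<longleftrightarrow>
     (\<forall>A\<in>F. \<forall>B\<in>F. A \<noteq> B \<longrightarrow> (\<forall>P. prefix P A \<longrightarrow> set P \<noteq> set B))"

text \<open>
  \<open>psf_family k d n X F\<close> says that \<open>F\<close> is a \<open>[k,d,n]\<close> PSF family over the ground set \<open>X\<close>.
  Such an \<open>F\<close> is always finite, so \<^const>\<open>card\<close> is its genuine size.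
\<close>

definition psf_family :: "nat \<Rightarrow> nat \<Rightarrow> nat \<Rightarrow> 'a set \<Rightarrow> 'a list set \<Rightarrow> bool" where
  "psf_family k d n X F \<longleftrightarrow>
     finite X \<and> card X = n \<and>
     (\<forall>A\<in>F. ordered_set X A) \<and>
     prefix_set_free F \<and>
     (\<forall>A\<in>F. k \<le> length A) \<and>
     2 ^ d \<le> card F"

text \<open>
  A vertex is the list of left/right choices leading to it, most recent choice first; the root
  is \<open>[]\<close> and the parent of \<open>b # v\<close> is \<open>v\<close>. The \<open>m\<close> levels are the lists of length
  \<open>0, \<dots>, m - 1\<close>, and the undirected edges are represented by pairs of opposite arcs.
\<close>

definition binary_tree :: "nat \<Rightarrow> bool list pair_pre_digraph" where
  "binary_tree m =
     \<lparr> pverts = {v. length v < m},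
       parcs = {(v, b # v) | v b. length (b # v) < m} \<union>
               {(b # v, v) | v b. length (b # v) < m} \<rparr>"

lemma pair_graph_binary_tree: "pair_graph (binary_tree m)"
proof -
  have fin: "finite {v :: bool list. length v < m}"
  proof (rule finite_subset)
    show "{v :: bool list. length v < m} \<subseteq> {v. set v \<subseteq> UNIV \<and> length v \<le> m}" by auto
  qed (rule finite_lists_length_le, simp)
  have sub: "parcs (binary_tree m) \<subseteq> {v. length v < m} \<times> {v. length v < m}"
    by (auto simp: binary_tree_def)
  show ?thesis
  proof
    show "finite (parcs (binary_tree m))"
      using sub fin by (meson finite_SigmaI finite_subset)
    show "symmetric (with_proj (binary_tree m))"
      by (auto simp: symmetric_def sym_def binary_tree_def)
  qed (use sub fin in \<open>auto simp: binary_tree_def\<close>)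
qed

definition conflict_free_coloring :: "('a, 'b) pre_digraph \<Rightarrow> nat \<Rightarrow> ('a \<Rightarrow> nat) \<Rightarrow> bool" where
  "conflict_free_coloring G c C \<longleftrightarrow>
     (\<forall>v\<in>verts G. C v \<in> {1..c}) \<and>
     (\<forall>p. vpath p G \<longrightarrow> (\<exists>i. \<exists>!v. v \<in> set p \<and> C v = i))"

definition CF :: "('a, 'b) pre_digraph \<Rightarrow> nat" where
  "CF G = (LEAST c. \<exists>C. conflict_free_coloring G c C)"

text \<open>On finite graphs the minimum is attained, so \<^const>\<open>Least\<close> is never unspecified there.\<close>

lemma CF_attained:
  assumes "finite (verts G)"
  shows "\<exists>C. conflict_free_coloring G (CF G) C"
  unfolding CF_def
proof (rule LeastI_ex)
  obtain f :: "'a \<Rightarrow> nat" where f: "bij_betw f (verts G) {1..card (verts G)}"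
    using assms by (metis ex_bij_betw_finite_nat bij_betw_iff_card card_atLeastAtMost
        diff_Suc_1 finite_atLeastAtMost)
  have "\<exists>i. \<exists>!v. v \<in> set p \<and> f v = i" if "vpath p G" for p
  proof -
    have "set p \<subseteq> verts G" "p \<noteq> []" using that by (auto simp: vpath_def vwalk_def)
    moreover have "inj_on f (verts G)" using f by (simp add: bij_betw_def)
    ultimately have "\<exists>!v. v \<in> set p \<and> f v = f (hd p)"
      by (intro ex1I[of _ "hd p"]) (auto simp: inj_on_def subset_iff)
    then show ?thesis by blast
  qed
  then have "conflict_free_coloring G (card (verts G)) f"
    using f by (auto simp: conflict_free_coloring_def bij_betw_def)
  then show "\<exists>c C. conflict_free_coloring G c C" by blast
qed

end

theory Submission
  imports Defs
begin

text \<open>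
  The levels come in \<open>r\<close> rounds followed by \<open>d\<close> final levels. A round starts with \<open>d\<close> choice levels,
  whose \<open>d\<close> colors are shared by all rounds. The \<open>d\<close> bits chosen there select a member \<open>A\<close> of the
  family, and the next \<open>length A\<close> levels are colored by the entries of \<open>A\<close>, in a copy of the ground
  set reserved for that round. A path goes up to a top vertex and down again. If the top vertex lies
  in the \<open>A\<close>-part of a round, its color does not occur below it; the same holds if it lies in the
  choice levels and the path does not leave that round. Otherwise one arm of the path exhausts its
  ordered set \<open>A\<close>, while the other arm meets a prefix of a different member; by prefix set-freeness
  these two sets differ, and an element of their symmetric difference is a color used once.
\<close>

section \<open>Shape of paths in the binary tree\<close>

text \<open>Read from the root, ancestors are prefixes. A path has a highest vertex \<open>t\<close>
  and two arms \<open>x\<close>, \<open>y\<close> below it, which part at the first step.\<close>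

lemma binary_tree_vpath_shape:
  assumes "vpath p (with_proj (binary_tree m))"
  obtains t x y where "rev ` set p = (@) t ` {z. prefix z x \<or> prefix z y}"
    and "x = [] \<or> y = [] \<or> hd x \<noteq> hd y"
proof -
  \<comment> \<open>The path grows at its head, so the induction also records that the head ends the
    arm \<open>x\<close>.\<close>
  have "\<exists>t x y. rev (hd p) = t @ x \<and> rev ` set p = (@) t ` {z. prefix z x \<or> prefix z y}
      \<and> (x = [] \<or> y = [] \<or> hd x \<noteq> hd y)"
    if "vwalk p (with_proj (binary_tree m))" "distinct p" for p
    using that
  proof (induction p rule: vwalk_arcs.induct)
    case 1
    then show ?case by (simp add: vwalk_def)
  next
    case (2 v)
    show ?case by (intro exI[of _ "rev v"] exI[of _ "[]"]) auto
  next
    case (3 v w q)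
    then have "vwalk (w # q) (with_proj (binary_tree m))" "distinct (w # q)"
      by (auto simp: vwalk_def)
    from "3.IH"[OF this] obtain t x y where top: "rev w = t @ x"
      and arms: "rev ` set (w # q) = (@) t ` {z. prefix z x \<or> prefix z y}"
      and branch: "x = [] \<or> y = [] \<or> hd x \<noteq> hd y"
      unfolding list.sel(1) by blast
    have new: "rev v \<notin> (@) t ` {z. prefix z x \<or> prefix z y}"
      using "3.prems"(2) unfolding arms[symmetric] by auto
    have img: "rev ` set (v # w # q) = insert (rev v) ((@) t ` {z. prefix z x \<or> prefix z y})"
      using arms by simp
    have "(v, w) \<in> parcs (binary_tree m)"
      using "3.prems"(1) by (auto simp: vwalk_def arcs_ends_def arc_to_ends_def)
    then consider b where "w = b # v" | b where "v = b # w"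
      by (auto simp: binary_tree_def)
    then show ?case
    proof cases
      case (1 b)
      \<comment> \<open>Going up is possible only from the top: otherwise the parent already lies on
        the arm \<open>x\<close>.\<close>
      have x: "x = []"
      proof (rule ccontr)
        assume "x \<noteq> []"
        then have "rev v = t @ butlast x" using top 1
          by (metis butlast_append butlast_snoc rev.simps(2))
        moreover have "prefix (butlast x) x"
          by (metis append_butlast_last_id \<open>x \<noteq> []\<close> prefixI)
        ultimately show False using new by blast
      qed
      have t: "t = rev v @ [b]" using top 1 x by simp
      have "insert (rev v) ((@) t ` {z. prefix z x \<or> prefix z y})
          = (@) (rev v) ` {z. prefix z [] \<or> prefix z (b # y)}"
        unfolding t x by (auto simp: prefix_Cons image_iff)
      then show ?thesis using img
        by (intro exI[of _ "rev v"] exI[of _ "[]"] exI[of _ "b # y"]) simp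
    next
      case (2 b)
      have v: "rev v = t @ x @ [b]" using 2 top by simp
      have "insert (rev v) ((@) t ` {z. prefix z x \<or> prefix z y})
          = (@) t ` {z. prefix z (x @ [b]) \<or> prefix z y}"
        unfolding v by auto
      \<comment> \<open>Only a first letter of \<open>x\<close> can spoil the branching; were it
        \<open>hd y\<close>, the new vertex would already lie on the arm \<open>y\<close>.\<close>
      moreover have "x @ [b] = [] \<or> y = [] \<or> hd (x @ [b]) \<noteq> hd y"
      proof (cases "x = [] \<and> y \<noteq> []")
        case True
        then have "prefix [hd y] y" by (cases y) auto
        then have "b \<noteq> hd y" using new v True by auto
        then show ?thesis using True by simp
      next
        case False
        then show ?thesis using branch by auto
      qed
      ultimately show ?thesis using img v
        by (intro exI[of _ t] exI[of _ "x @ [b]"] exI[of _ y]) simp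
    qed
  qed
  with assms that show thesis by (meson vpathE)
qed

section \<open>Coloring built from a labelling\<close>

text \<open>The \<open>d\<close> choice bits index members of the family, and the ground set is
  renumbered to \<open>{1..n}\<close> so that entries serve as color offsets.\<close>

locale psf_labelling =
  fixes d k n :: nat and g :: "bool list \<Rightarrow> nat list"
  assumes dist: "length u = d \<Longrightarrow> distinct (g u)"
    and range: "length u = d \<Longrightarrow> set (g u) \<subseteq> {1..n}"
    and long: "length u = d \<Longrightarrow> k \<le> length (g u)"
    and psf: "length u = d \<Longrightarrow> length v = d \<Longrightarrow> u \<noteq> v \<Longrightarrow> prefix P (g u) \<Longrightarrow> set P \<noteq> set (g v)"
begin

text \<open>The color of the vertex reached from the root by the choices \<open>w\<close>, first choice first, when
  \<open>r\<close> rounds are left.\<close>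

primrec col :: "nat \<Rightarrow> bool list \<Rightarrow> nat" where
  "col 0 w = Suc (length w)"
| "col (Suc r) w =
    (if length w < d then Suc (length w)
     else let A = g (take d w); i = length w - d
       in if i < length A then d + r * n + A ! i else col r (drop (d + length A) w))"

declare col.simps(2) [simp del]

abbreviation depth :: "nat \<Rightarrow> nat" where
  "depth r \<equiv> d * (r + 1) + k * r"

text \<open>Labels have at least \<open>k\<close> entries, so a completed round uses up at least
  \<open>d + k\<close> levels, the difference of consecutive depths.\<close>

lemma depth_drop:
  assumes "length w < depth (Suc r)" "d + length (g (take d w)) \<le> length w"
  shows "length (drop (d + length (g (take d w))) w) < depth r"
  using assms long[of "take d w"] by (simp add: algebra_simps)

lemma col_choice: "length w < d \<Longrightarrow> col r w = Suc (length w)"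
  by (cases r) (auto simp: col.simps)

lemma col_label:
  "d \<le> length w \<Longrightarrow> length w < d + length (g (take d w)) \<Longrightarrow>
    col (Suc r) w = d + r * n + g (take d w) ! (length w - d)"
  by (auto simp: col.simps Let_def)

lemma col_later:
  "d + length (g (take d w)) \<le> length w \<Longrightarrow>
    col (Suc r) w = col r (drop (d + length (g (take d w))) w)"
  by (auto simp: col.simps Let_def)

lemma label_range:
  "length u = d \<Longrightarrow> i < length (g u) \<Longrightarrow> 1 \<le> g u ! i \<and> g u ! i \<le> n"
  using range[of u] nth_mem[of i "g u"] by fastforce

lemma col_range: "length w < depth r \<Longrightarrow> col r w \<in> {1..d + r * n}"
proof (induction r arbitrary: w)
  case 0
  then show ?case by simp
next
  case (Suc r)
  let ?A = "g (take d w)"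
  consider "length w < d" | "d \<le> length w" "length w < d + length ?A" | "d + length ?A \<le> length w"
    by linarith
  then show ?case
  proof cases
    case 1
    then show ?thesis by (simp add: col_choice)
  next
    case 2
    then have "1 \<le> ?A ! (length w - d) \<and> ?A ! (length w - d) \<le> n"
      by (intro label_range) auto
    then show ?thesis using 2 by (simp add: col_label)
  next
    case 3
    then have "col r (drop (d + length ?A) w) \<in> {1..d + r * n}"
      using Suc.prems depth_drop by (intro Suc.IH) blast
    then show ?thesis using 3 by (simp add: col_later)
  qed
qed

section \<open>Colors private to the current round\<close>

text \<open>Choice levels and later rounds use colors up to \<open>d + r * n\<close> only, so all
  higher ones are reserved for the labels of this round.\<close>

lemma col_fresh_iff:
  assumes "length w < depth (Suc r)" "1 \<le> c"
  shows "col (Suc r) w = d + r * n + c \<longleftrightarrow>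
    d \<le> length w \<and> length w < d + length (g (take d w)) \<and> g (take d w) ! (length w - d) = c"
proof -
  let ?A = "g (take d w)"
  consider "length w < d" | "d \<le> length w" "length w < d + length ?A" | "d + length ?A \<le> length w"
    by linarith
  then show ?thesis
  proof cases
    case 3
    then have "col (Suc r) w \<le> d + r * n"
      using col_range[OF depth_drop] assms(1) by (auto simp: col_later)
    then show ?thesis using 3 assms(2) by auto
  qed (use assms in \<open>auto simp: col_choice col_label\<close>)
qed

text \<open>The part of its label that the descent from the root to \<open>w\<close> meets in the first round.\<close>

definition cover :: "bool list \<Rightarrow> nat set" where
  "cover w = set (take (Suc (length w) - d) (g (take d w)))"

text \<open>As \<open>t\<close> lies above the label levels, the arm down to \<open>t @ x\<close>
  meets the same label entries as the descent from the root.\<close>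

lemma arm_hit_iff:
  assumes "length (t @ x) < depth (Suc r)" "length t < d" "1 \<le> c"
  shows "(\<exists>z. prefix z x \<and> col (Suc r) (t @ z) = d + r * n + c) \<longleftrightarrow> c \<in> cover (t @ x)"
proof
  assume "\<exists>z. prefix z x \<and> col (Suc r) (t @ z) = d + r * n + c"
  then obtain z where z: "prefix z x" "col (Suc r) (t @ z) = d + r * n + c" by blast
  then obtain z' where x: "x = z @ z'" by (elim prefixE)
  have hit: "d \<le> length (t @ z)" "length (t @ z) < d + length (g (take d (t @ z)))"
    "g (take d (t @ z)) ! (length (t @ z) - d) = c"
    using z(2) col_fresh_iff[of "t @ z" r c] assms x by auto
  moreover have "take d (t @ z) = take d (t @ x)" using hit(1) x by simp
  ultimately show "c \<in> cover (t @ x)"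
    using x unfolding cover_def by (auto simp: in_set_conv_nth intro!: exI[of _ "length (t @ z) - d"])
next
  assume "c \<in> cover (t @ x)"
  \<comment> \<open>Entry \<open>i\<close> sits at depth \<open>d + i\<close>, hence the
    \<open>Suc\<close>; for words shorter than \<open>d\<close> the truncated difference is
    0.\<close>
  then obtain i where i: "i < Suc (length (t @ x)) - d" "i < length (g (take d (t @ x)))"
      "g (take d (t @ x)) ! i = c"
    unfolding cover_def by (auto simp: in_set_conv_nth)
  define z where "z = take (d + i - length t) x"
  have len: "length (t @ z) = d + i" using i(1) assms(2) by (auto simp: z_def)
  have pre: "prefix z x" by (simp add: z_def take_is_prefix)
  then have "take d (t @ z) = take d (t @ x)" using len by (auto simp: prefix_def)
  then have "col (Suc r) (t @ z) = d + r * n + c"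
    using len i by (subst col_label) auto
  with pre show "\<exists>z. prefix z x \<and> col (Suc r) (t @ z) = d + r * n + c" by blast
qed

text \<open>Fresh colors on one arm are entries of one label; these are distinct, so equal colors
  mean equal depth.\<close>

lemma arm_hit_unique:
  assumes "length (t @ x) < depth (Suc r)" "1 \<le> c" "prefix z x" "prefix z' x"
    and "col (Suc r) (t @ z) = d + r * n + c" "col (Suc r) (t @ z') = d + r * n + c"
  shows "z = z'"
proof -
  have hit: "d \<le> length (t @ w)" "length (t @ w) < d + length (g (take d (t @ x)))"
    "g (take d (t @ x)) ! (length (t @ w) - d) = c"
    if w: "prefix w x" "col (Suc r) (t @ w) = d + r * n + c" for w
  proof -
    obtain w' where x: "x = w @ w'" using w(1) by (elim prefixE)
    have *: "d \<le> length (t @ w)" "length (t @ w) < d + length (g (take d (t @ w)))"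
      "g (take d (t @ w)) ! (length (t @ w) - d) = c"
      using w(2) col_fresh_iff[of "t @ w" r c] assms(1,2) x by auto
    have "take d (t @ w) = take d (t @ x)" using *(1) x by simp
    with * show "d \<le> length (t @ w)" "length (t @ w) < d + length (g (take d (t @ x)))"
      "g (take d (t @ x)) ! (length (t @ w) - d) = c" by simp_all
  qed
  note h = hit[OF assms(3,5)] hit[OF assms(4,6)]
  have "d \<le> length (t @ x)" using h(1) prefix_length_le[OF assms(3)] by simp
  then have "distinct (g (take d (t @ x)))" by (intro dist) simp
  then have "length (t @ z) - d = length (t @ z') - d"
    using h by (auto simp: nth_eq_iff_index_eq[symmetric])
  then have "length z = length z'" using h(1,4) by simp
  with assms(3,4) show ?thesis by (metis prefix_def append_eq_append_conv)
qed

lemma unique_fresh_color: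
  assumes "length (t @ x) < depth (Suc r)" "length (t @ y) < depth (Suc r)" "length t < d"
    and "1 \<le> c" "c \<in> cover (t @ x)" "c \<notin> cover (t @ y)"
  shows "\<exists>!z. (prefix z x \<or> prefix z y) \<and> col (Suc r) (t @ z) = d + r * n + c"
  using arm_hit_iff[OF assms(1,3,4)] arm_hit_iff[OF assms(2,3,4)] assms(5,6)
    arm_hit_unique[OF assms(1,4)] by blast

lemma cover_range: "cover w \<subseteq> {1..n}"
proof (cases "d \<le> length w")
  case True
  then show ?thesis
    using range[of "take d w"] set_take_subset unfolding cover_def by fastforce
qed (simp add: cover_def)

text \<open>The arm \<open>x\<close> exhausts its label. The arms part among the choice bits, so
  \<open>y\<close> meets only a prefix of another label, possibly empty.\<close>

lemma cover_neq:
  assumes "length t < d" "d + length (g (take d (t @ x))) \<le> length (t @ x)"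
    and branch: "x = [] \<or> y = [] \<or> hd x \<noteq> hd y"
  shows "cover (t @ x) \<noteq> cover (t @ y)"
proof -
  let ?u = "take d (t @ x)"
  have u: "length ?u = d" using assms(2) by simp
  have full: "cover (t @ x) = set (g ?u)" using assms(2) by (simp add: cover_def)
  show ?thesis
  proof (cases "d \<le> length (t @ y)")
    case True
    let ?v = "take d (t @ y)"
    have v: "length ?v = d" using True by simp
    have "x \<noteq> []" "y \<noteq> []" using assms(1,2) True by auto
    then have "?u ! length t \<noteq> ?v ! length t"
      using branch assms(1) by (simp add: nth_append hd_conv_nth)
    then have "?v \<noteq> ?u" by metis
    then show ?thesis
      using psf[OF v u, of "take (Suc (length (t @ y)) - d) (g ?v)"] full
      by (metis cover_def take_is_prefix)
  next
    case False
    \<comment> \<open>Here \<open>y\<close> ends above the labels and covers nothing. Since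
      \<open>d > 0\<close>, another word of length \<open>d\<close> exists, and the empty prefix of
      its label shows that \<open>g ?u\<close> is nonempty.\<close>
    have "d \<noteq> 0" using assms(1) by simp
    then obtain v where v: "length v = d" "v \<noteq> ?u"
      by (metis (full_types) length_0_conv length_replicate nth_replicate not_gr0)
    have "set (g ?u) \<noteq> {}" using psf[OF v(1) u v(2), of "[]"] by simp
    moreover have "cover (t @ y) = {}" using False by (simp add: cover_def)
    ultimately show ?thesis using full by simp
  qed
qed

lemma unique_color_if_leaving:
  assumes bounds: "length (t @ x) < depth (Suc r)" "length (t @ y) < depth (Suc r)"
    and "length t < d" "cover (t @ x) \<noteq> cover (t @ y)"
  shows "\<exists>i. \<exists>!z. (prefix z x \<or> prefix z y) \<and> col (Suc r) (t @ z) = i"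
proof -
  consider c where "c \<in> cover (t @ x)" "c \<notin> cover (t @ y)"
    | c where "c \<in> cover (t @ y)" "c \<notin> cover (t @ x)"
    using assms(4) by blast
  then show ?thesis
  proof cases
    case (1 c)
    then have "1 \<le> c" using cover_range[of "t @ x"] by auto
    with unique_fresh_color[OF bounds assms(3) _ 1] show ?thesis by blast
  next
    case (2 c)
    then have "1 \<le> c" using cover_range[of "t @ y"] by auto
    with unique_fresh_color[OF bounds(2,1) assms(3) _ 2] show ?thesis by (subst disj_commute) blast
  qed
qed

section \<open>Top vertices and conflict-freeness\<close>

lemma unique_top_color:
  assumes "\<And>z. prefix z x \<or> prefix z y \<Longrightarrow> f (t @ z) = f t \<Longrightarrow> z = []"
  shows "\<exists>i. \<exists>!z. (prefix z x \<or> prefix z y) \<and> f (t @ z) = i"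
  using assms by (intro exI[of _ "f t"] ex1I[of _ "[]"]) auto

text \<open>Below \<open>t\<close> this color can come only from the label of \<open>t\<close>,
  whose entries are distinct.\<close>

lemma col_label_top:
  assumes "length (t @ z) < depth (Suc r)" "d \<le> length t" "length t < d + length (g (take d t))"
    and "col (Suc r) (t @ z) = col (Suc r) t"
  shows "z = []"
proof -
  let ?A = "g (take d t)"
  have u: "length (take d t) = d" using assms(2) by simp
  have top: "1 \<le> ?A ! (length t - d)" "col (Suc r) t = d + r * n + ?A ! (length t - d)"
    using assms(2,3) label_range[OF u] col_label by auto
  then have "length (t @ z) < d + length ?A" "?A ! (length (t @ z) - d) = ?A ! (length t - d)"
    using assms col_fresh_iff[OF assms(1) top(1)] by auto
  then have "length (t @ z) - d = length t - d"
    using dist[OF u] assms(2,3) nth_eq_iff_index_eq[of ?A] by simp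
  moreover have "d \<le> length (t @ z)" using assms(2) by simp
  ultimately have "length (t @ z) = length t" using assms(2) by linarith
  then show ?thesis by simp
qed

text \<open>Inside the round, choice colors grow with depth and label colors exceed
  \<open>d\<close>. Beyond it the color of \<open>t\<close> may recur, hence the third
  assumption.\<close>

lemma col_choice_top:
  assumes "length (t @ z) < depth (Suc r)" "length t < d"
    "length (t @ z) < d + length (g (take d (t @ z)))" "col (Suc r) (t @ z) = col (Suc r) t"
  shows "z = []"
proof (cases "length (t @ z) < d")
  case True
  then show ?thesis using assms(2,4) by (simp add: col_choice)
next
  case False
  then have "1 \<le> g (take d (t @ z)) ! (length (t @ z) - d)"
    using assms(3) by (intro conjunct1[OF label_range]) auto
  then have "d < col (Suc r) (t @ z)"
    using False assms(3) by (subst col_label) auto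
  then show ?thesis using assms(2,4) by (simp add: col_choice)
qed

lemma col_conflict_free:
  assumes "length (t @ x) < depth r" "length (t @ y) < depth r" "x = [] \<or> y = [] \<or> hd x \<noteq> hd y"
  shows "\<exists>i. \<exists>!z. (prefix z x \<or> prefix z y) \<and> col r (t @ z) = i"
  using assms(1,2)
proof (induction r arbitrary: t)
  case 0
  show ?case by (rule unique_top_color) simp
next
  case (Suc r)
  have bound: "length (t @ z) < depth (Suc r)" if "prefix z x \<or> prefix z y" for z
    using Suc.prems that by (auto dest: prefix_length_le)
  let ?A = "g (take d t)"
  let ?leaves = "\<lambda>x. d + length (g (take d (t @ x))) \<le> length (t @ x)"
  consider (label) "d \<le> length t" "length t < d + length ?A"
    | (later) "d \<le> length t" "d + length ?A \<le> length t"
    | (leave_x) "length t < d" "?leaves x" | (leave_y) "length t < d" "?leaves y"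
    | (stay) "length t < d" "\<not> ?leaves x" "\<not> ?leaves y"
    by linarith
  then show ?case
  proof cases
    case label
    then show ?thesis using bound col_label_top by (intro unique_top_color) blast
  next
    case later
    \<comment> \<open>The whole path lies beyond the first round, below one fixed label; removing
      that round leaves a path with \<open>r\<close> rounds to go.\<close>
    have shift: "col (Suc r) (t @ z) = col r (drop (d + length ?A) t @ z)" for z
      using later by (simp add: col_later)
    have "length (drop (d + length ?A) t @ z) < depth r" if "length (t @ z) < depth (Suc r)" for z
      using depth_drop[OF that] later by simp
    then show ?thesis unfolding shift using Suc.prems by (intro Suc.IH) blast+
  next
    case leave_x
    then show ?thesis
      using unique_color_if_leaving[OF Suc.prems] cover_neq assms(3) by blast
  next
    case leave_y
    then have "cover (t @ y) \<noteq> cover (t @ x)" using cover_neq assms(3) by blast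
    then show ?thesis
      using unique_color_if_leaving[OF Suc.prems] leave_y(1) by metis
  next
    case stay
    \<comment> \<open>If \<open>w\<close> stops inside the round, so does every vertex above it on
      the arm, because the label is fixed once \<open>d\<close> bits are read.\<close>
    have inside: "length (t @ z) < d + length (g (take d (t @ z)))"
      if pre: "prefix z w" "\<not> ?leaves w" for z w
    proof (cases "length (t @ z) < d")
      case False
      obtain w' where w: "w = z @ w'" using pre(1) by (elim prefixE)
      then have "take d (t @ w) = take d (t @ z)" "length (t @ z) \<le> length (t @ w)"
        using False by simp_all
      then show ?thesis using pre(2) by (metis le_trans not_le)
    qed simp
    show ?thesis
    proof (rule unique_top_color)
      fix z assume z: "prefix z x \<or> prefix z y" "col (Suc r) (t @ z) = col (Suc r) t"
      then show "z = []" using col_choice_top bound inside stay by blast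
    qed
  qed
qed

text \<open>Vertices list the latest choice first while \<open>col\<close> reads from the root,
  hence the \<open>rev\<close>.\<close>

lemma conflict_free_coloring_col:
  "conflict_free_coloring (with_proj (binary_tree (depth r))) (n * r + d) (\<lambda>v. col r (rev v))"
  unfolding conflict_free_coloring_def
proof (intro conjI ballI allI impI)
  fix v assume "v \<in> verts (with_proj (binary_tree (depth r)))"
  then show "col r (rev v) \<in> {1..n * r + d}"
    using col_range[of "rev v" r] by (simp add: binary_tree_def algebra_simps)
next
  fix p assume p: "vpath p (with_proj (binary_tree (depth r)))"
  then obtain t x y where arms: "rev ` set p = (@) t ` {z. prefix z x \<or> prefix z y}"
    and branch: "x = [] \<or> y = [] \<or> hd x \<noteq> hd y"
    by (rule binary_tree_vpath_shape)
  have mem: "v \<in> set p \<longleftrightarrow> (\<exists>z. (prefix z x \<or> prefix z y) \<and> rev v = t @ z)" for v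
  proof -
    have "v \<in> set p \<longleftrightarrow> rev v \<in> rev ` set p" by auto
    then show ?thesis unfolding arms by auto
  qed
  have len: "length (t @ z) < depth r" if "prefix z x \<or> prefix z y" for z
  proof -
    have "rev (t @ z) \<in> set p" using mem that by auto
    then have "rev (t @ z) \<in> pverts (binary_tree (depth r))"
      using p by (auto simp: vpath_def vwalk_def)
    then show ?thesis by (simp add: binary_tree_def)
  qed
  obtain i z where z: "prefix z x \<or> prefix z y" "col r (t @ z) = i"
    and uniq: "\<And>z'. prefix z' x \<or> prefix z' y \<Longrightarrow> col r (t @ z') = i \<Longrightarrow> z' = z"
    using col_conflict_free[OF len len branch] by blast
  have "\<exists>!v. v \<in> set p \<and> col r (rev v) = i"
  proof (rule ex1I[of _ "rev (t @ z)"])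
    show "rev (t @ z) \<in> set p \<and> col r (rev (rev (t @ z))) = i" using z mem by auto
  next
    fix v assume v: "v \<in> set p \<and> col r (rev v) = i"
    then obtain z' where "prefix z' x \<or> prefix z' y" "rev v = t @ z'" using mem by blast
    then show "v = rev (t @ z)" using uniq[of z'] v by (metis rev_rev_ident)
  qed
  then show "\<exists>i. \<exists>!v. v \<in> set p \<and> col r (rev v) = i" by blast
qed

lemma CF_binary_tree_le: "CF (with_proj (binary_tree (depth r))) \<le> n * r + d"
  unfolding CF_def using conflict_free_coloring_col by (intro Least_le) blast

end

section \<open>From a PSF family to a labelling\<close>

text \<open>At least \<open>2 ^ d\<close> members allow an injective indexing by the words of length
  \<open>d\<close>.\<close>

lemma psf_family_labelling:
  assumes "psf_family k d n X F"
  obtains g where "psf_labelling d k n g"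
proof -
  from assms have X: "finite X" "card X = n" and ord: "\<And>A. A \<in> F \<Longrightarrow> distinct A \<and> set A \<subseteq> X"
    and psf: "\<And>A B P. A \<in> F \<Longrightarrow> B \<in> F \<Longrightarrow> A \<noteq> B \<Longrightarrow> prefix P A \<Longrightarrow> set P \<noteq> set B"
    and long: "\<And>A. A \<in> F \<Longrightarrow> k \<le> length A" and big: "2 ^ d \<le> card F"
    by (auto simp: psf_family_def ordered_set_def prefix_set_free_def)
  obtain h where h: "bij_betw h X {1..n}"
    using X by (metis card_atLeastAtMost diff_Suc_1 finite_atLeastAtMost finite_same_card_bij)
  let ?W = "{w :: bool list. length w = d}"
  \<comment> \<open>\<open>card\<close> is 0 on infinite sets, so a positive lower bound gives
    finiteness.\<close>
  have "finite F" using big by (intro card_ge_0_finite) (simp add: less_le_trans[of 0 "2 ^ d"])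
  moreover have "finite ?W" "card ?W = 2 ^ d"
    using finite_lists_length_eq[of "UNIV :: bool set" d] card_lists_length_eq[of "UNIV :: bool set" d]
    by (simp_all add: card_UNIV_bool)
  ultimately obtain f where f: "f ` ?W \<subseteq> F" "inj_on f ?W"
    using big card_le_inj[of ?W F] by auto
  have "psf_labelling d k n (\<lambda>u. map h (f u))"
  proof
    fix u :: "bool list" assume u: "length u = d"
    then have fu: "f u \<in> F" using f(1) by auto
    show "distinct (map h (f u))"
      using ord[OF fu] h inj_on_subset[of h X] by (simp add: distinct_map bij_betw_def)
    show "set (map h (f u)) \<subseteq> {1..n}" using ord[OF fu] h by (auto simp: bij_betw_def)
    show "k \<le> length (map h (f u))" using long[OF fu] by simp
    fix v P assume v: "length v = d" "u \<noteq> v" and P: "prefix P (map h (f u))"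
    have fv: "f v \<in> F" "f u \<noteq> f v" using f u v by (auto simp: inj_on_def)
    obtain Q where Q: "prefix Q (f u)" "P = map h Q"
      using P by (auto simp: prefix_def map_eq_append_conv append_eq_map_conv)
    \<comment> \<open>\<open>h\<close> is injective on \<open>X\<close>, so equal images would give
      \<open>set Q = set (f v)\<close>, against prefix set-freeness.\<close>
    have "set Q \<subseteq> X" using set_mono_prefix[OF Q(1)] ord[OF fu] by blast
    then show "set P \<noteq> set (map h (f v))"
      using psf[OF fu fv Q(1)] ord[OF fv(1)] h Q(2) inj_on_image_eq_iff[of h X "set Q" "set (f v)"]
      by (simp add: bij_betw_def)
  qed
  then show thesis by (rule that)
qed

theorem theorem6:
  fixes k d n :: nat and X :: "'a set" and F :: "'a list set"
  assumes "psf_family k d n X F"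
    and "\<forall>A\<in>F. length A \<le> k + d"
  shows "\<forall>r::nat. r > 0 \<longrightarrow> CF (with_proj (binary_tree (d * (r + 1) + k * r))) \<le> n * r + d"
  using psf_family_labelling[OF assms(1)] psf_labelling.CF_binary_tree_le by metis

end
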